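(* Let $(F:\mathcal C\to\mathcal D,\ G:\mathcal S^{\mathrm{op}}\to\mathcal D)$ be any pair of functors into a category $\mathcal D$ which satisfies the Beck-Chevalley property and the identity $Gs\cdot Fs=1$ for all $s\in\mathcal S$. Then there is a uniquely determined functor $H:\mathsf{Sect}(\mathcal C,\mathcal S)\to\mathcal D$ with $F=H\Phi_{\mathrm a}$ and $G=H\Psi_{\mathrm a}$.
   Context: Standing assumptions: $\mathcal C$ is a category and $\mathcal S$ is a class of morphisms of $\mathcal C$ that contains all isomorphisms, is closed under composition, and is such that pullbacks of $\mathcal S$-morphisms along arbitrary morphisms exist in $\mathcal C$ and belong to $\mathcal S$. $\mathcal S$ is also regarded as a subcategory of $\mathcal C$ with the same objects. $\mathcal S$-spans: an $\mathcal S$-span $(s,f):A\to B$ is a pair $s:D\to A$ in $\mathcal S$, $f:D\to B$ in $\mathcal C$. A (vertical) morphism $x:(s,f)\to(\tilde s,\tilde f)$ of $\mathcal S$-spans from $A$ to $B$ is a $\mathcal C$-morphism $x$ with $\tilde s\cdot x=s$, $\tilde f\cdot x=f$. Isomorphic $\mathcal S$-spans are identified. $\mathsf{Span}(\mathcal C,\mathcal S)$ is the category with the objects of $\mathcal C$ and (isomorphism classes of) $\mathcal S$-spans as morphisms, with (horizontal) composition $(t,g)\cdot(s,f)=(s\cdot t',g\cdot f')$, where $(t',f')$ is the pullback of $(f,t)$, i.e. $f\cdot t'=t\cdot f'$ is a pullback square. A relation for $\mathcal S$-spans is compatible if it relates only $\mathcal S$-spans with the same domain and codomain, relates vertically isomorphic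 $\mathcal S$-spans, and is preserved by horizontal composition from either side. The least equivalence relation generated by a compatible relation is again compatible. For a compatible equivalence relation $\sim$, $\mathsf{Span}_\sim(\mathcal C,\mathcal S)$ is the quotient category whose morphisms are the classes $[s,f]_\sim$. $\mathcal S$-cospans: an $\mathcal S$-cospan $\langle f,s\rangle:A\to B$ is (the isomorphism class of) a pair $f:A\to D$ in $\mathcal C$, $s:B\to D$ in $\mathcal S$. A morphism $v:\langle f,s\rangle\to\langle\tilde f,\tilde s\rangle$ is a $\mathcal C$-morphism $v$ with $v\cdot f=\tilde f$, $v\cdot s=\tilde s$. One writes $\langle f,s\rangle\preceq\langle\tilde f,\tilde s\rangle$ if there is such a morphism $v$ with $v\in\mathcal S$. $\mathrm{pb}\langle f,s\rangle:=(s',f')$ is the $\mathcal S$-span given by the pullback square $f\cdot s'=s\cdot f'$. $\approx_{\mathrm a}$ is the least compatible relation for $\mathcal S$-spans such that $\langle f,s\rangle\preceq\langle g,t\rangle$ implies $\mathrm{pb}\langle f,s\rangle\approx_{\mathrm a}\mathrm{pb}\langle g,t\rangle$. $\sim_{\mathrm a}$ is the equivalence relation generated by $\approx_{\mathrm a}$ (it is compatible), and $\mathsf{Sect}(\mathcal C,\mathcal S):=\mathsf{Span}_{\sim_{\mathrm a}}(\mathcal C,\mathcal S)$, with the identity-on-objects functors $\Phi_{\mathrm a}:\mathcal C\to\mathsf{Sect}(\mathcal C,\mathcal S)$, $f\mapsto[1,f]_{\mathrm a}$, and $\Psi_{\mathrm a}:\mathcal S^{\mathrm{op}}\to\mathsf{Sect}(\mathcal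 C,\mathcal S)$, $s\mapsto[s,1]_{\mathrm a}$. A pair of functors $F:\mathcal C\to\mathcal D$, $G:\mathcal S^{\mathrm{op}}\to\mathcal D$ satisfies the Beck-Chevalley property if $F$ and $G$ coincide on objects and, for every pullback square $s\cdot f'=f\cdot s'$ in $\mathcal C$ with $s\in\mathcal S$ ($s'$ being the pullback of $s$ along $f$), one has $Gs\cdot Ff=Ff'\cdot Gs'$. *)

theory Defs
  imports Main
begin

section \<open>Categories and functors\<close>

record ('o, 'a) cat =
  Obj :: "'o set"
  Arr :: "'a set"
  Dom :: "'a \<Rightarrow> 'o"
  Cod :: "'a \<Rightarrow> 'o"
  Ident :: "'o \<Rightarrow> 'a"
  Comp :: "'a \<Rightarrow> 'a \<Rightarrow> 'a"  (infixl "\<cdot>\<index>" 70)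

text \<open>Composition is written in the usual order: \<open>g \<cdot> f\<close> is meaningful if the codomain of
  \<open>f\<close> is the domain of \<open>g\<close>; otherwise its value is irrelevant.\<close>

definition hom :: "('o, 'a) cat \<Rightarrow> 'o \<Rightarrow> 'o \<Rightarrow> 'a set" where
  "hom C A B = {f \<in> Arr C. Dom C f = A \<and> Cod C f = B}"

locale category =
  fixes C :: "('o, 'a) cat" (structure)
  assumes Dom_in_Obj: "f \<in> Arr C \<Longrightarrow> Dom C f \<in> Obj C"
    and Cod_in_Obj: "f \<in> Arr C \<Longrightarrow> Cod C f \<in> Obj C"
    and Ident_in_hom: "A \<in> Obj C \<Longrightarrow> Ident C A \<in> hom C A A"
    and Comp_in_hom: "f \<in> hom C X Y \<Longrightarrow> g \<in> hom C Y Z \<Longrightarrow> g \<cdot> f \<in> hom C X Z"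
    and Comp_Ident_right: "f \<in> hom C X Y \<Longrightarrow> f \<cdot> Ident C X = f"
    and Comp_Ident_left: "f \<in> hom C X Y \<Longrightarrow> Ident C Y \<cdot> f = f"
    and Comp_assoc: "f \<in> hom C W X \<Longrightarrow> g \<in> hom C X Y \<Longrightarrow> h \<in> hom C Y Z \<Longrightarrow>
      h \<cdot> g \<cdot> f = h \<cdot> (g \<cdot> f)"

definition op_cat :: "('o, 'a) cat \<Rightarrow> ('o, 'a) cat" where
  "op_cat C = \<lparr>Obj = Obj C, Arr = Arr C, Dom = Cod C, Cod = Dom C, Ident = Ident C,
     Comp = (\<lambda>g f. Comp C f g)\<rparr>"

definition wide_subcat :: "('o, 'a) cat \<Rightarrow> 'a set \<Rightarrow> ('o, 'a) cat" where
  "wide_subcat C S = C\<lparr>Arr := S\<rparr>"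

record ('o, 'a, 'p, 'b) ftor =
  omap :: "'o \<Rightarrow> 'p"
  amap :: "'a \<Rightarrow> 'b"

locale cat_functor = src: category C + tgt: category D
  for C :: "('o, 'a) cat" and D :: "('p, 'b) cat" and F :: "('o, 'a, 'p, 'b) ftor" +
  assumes omap_in_Obj: "A \<in> Obj C \<Longrightarrow> omap F A \<in> Obj D"
    and amap_in_hom: "f \<in> hom C A B \<Longrightarrow> amap F f \<in> hom D (omap F A) (omap F B)"
    and amap_Ident: "A \<in> Obj C \<Longrightarrow> amap F (Ident C A) = Ident D (omap F A)"
    and amap_Comp: "f \<in> hom C X Y \<Longrightarrow> g \<in> hom C Y Z \<Longrightarrow>
      amap F (Comp C g f) = Comp D (amap F g) (amap F f)"

definition ftor_comp ::
    "('p, 'b, 'q, 'c) ftor \<Rightarrow> ('o, 'a, 'p, 'b) ftor \<Rightarrow> ('o, 'a, 'q, 'c) ftor" where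
  "ftor_comp G F = \<lparr>omap = omap G \<circ> omap F, amap = amap G \<circ> amap F\<rparr>"

text \<open>Functors are functions on the whole ambient types, whose values outside the source
  category carry no information; so equality of functors is agreement on that category.\<close>

definition ftor_eq ::
    "('o, 'a) cat \<Rightarrow> ('o, 'a, 'p, 'b) ftor \<Rightarrow> ('o, 'a, 'p, 'b) ftor \<Rightarrow> bool" where
  "ftor_eq C F G \<longleftrightarrow>
     (\<forall>A \<in> Obj C. omap F A = omap G A) \<and> (\<forall>f \<in> Arr C. amap F f = amap G f)"

definition iso :: "('o, 'a) cat \<Rightarrow> 'a \<Rightarrow> bool" where
  "iso C f \<longleftrightarrow> f \<in> Arr C \<and>
     (\<exists>g \<in> hom C (Cod C f) (Dom C f).
        Comp C g f = Ident C (Dom C f) \<and> Comp C f g = Ident C (Cod C f))"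

text \<open>\<open>pullback C f s s' f'\<close>: the square \<open>f \<cdot> s' = s \<cdot> f'\<close> is a pullback, with
  \<open>s'\<close> the pullback of \<open>s\<close> along \<open>f\<close>.\<close>

definition pullback :: "('o, 'a) cat \<Rightarrow> 'a \<Rightarrow> 'a \<Rightarrow> 'a \<Rightarrow> 'a \<Rightarrow> bool" where
  "pullback C f s s' f' \<longleftrightarrow>
     f \<in> Arr C \<and> s \<in> Arr C \<and> s' \<in> Arr C \<and> f' \<in> Arr C \<and>
     Cod C f = Cod C s \<and> Dom C s' = Dom C f' \<and> Cod C s' = Dom C f \<and> Cod C f' = Dom C s \<and>
     Comp C f s' = Comp C s f' \<and>
     (\<forall>Q. \<forall>x \<in> hom C Q (Dom C f). \<forall>y \<in> hom C Q (Dom C s). Comp C f x = Comp C s y \<longrightarrow>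
        (\<exists>!u. u \<in> hom C Q (Dom C s') \<and> Comp C s' u = x \<and> Comp C f' u = y))"

locale span_setting = category C
  for C :: "('o, 'a) cat" (structure) +
  fixes S :: "'a set"
  assumes S_subset: "S \<subseteq> Arr C"
    and iso_in_S: "iso C f \<Longrightarrow> f \<in> S"
    and Comp_in_S: "s \<in> S \<Longrightarrow> t \<in> S \<Longrightarrow> Dom C t = Cod C s \<Longrightarrow> t \<cdot> s \<in> S"
    and pullback_exists: "s \<in> S \<Longrightarrow> f \<in> Arr C \<Longrightarrow> Cod C f = Cod C s \<Longrightarrow>
      \<exists>s' f'. pullback C f s s' f'"
    and pullback_in_S: "s \<in> S \<Longrightarrow> pullback C f s s' f' \<Longrightarrow> s' \<in> S"

section \<open>Spans and their quotient categories\<close>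

text \<open>A span \<open>(s, f) : A \<rightarrow> B\<close> is a raw pair of arrows, with \<open>A\<close> the codomain of \<open>s\<close> and
  \<open>B\<close> the codomain of \<open>f\<close>. Isomorphic spans are identified only by way of compatible relations,
  which contain vertical isomorphism.\<close>

definition spans :: "('o, 'a) cat \<Rightarrow> 'a set \<Rightarrow> ('a \<times> 'a) set" where
  "spans C S = {(s, f). s \<in> S \<and> f \<in> Arr C \<and> Dom C s = Dom C f}"

definition sdom :: "('o, 'a) cat \<Rightarrow> 'a \<times> 'a \<Rightarrow> 'o" where
  "sdom C p = Cod C (fst p)"

definition scod :: "('o, 'a) cat \<Rightarrow> 'a \<times> 'a \<Rightarrow> 'o" where
  "scod C p = Cod C (snd p)"

definition span_mor :: "('o, 'a) cat \<Rightarrow> 'a \<times> 'a \<Rightarrow> 'a \<times> 'a \<Rightarrow> 'a \<Rightarrow> bool" where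
  "span_mor C p q x \<longleftrightarrow> x \<in> hom C (Dom C (fst p)) (Dom C (fst q)) \<and>
     Comp C (fst q) x = fst p \<and> Comp C (snd q) x = snd p"

definition span_iso :: "('o, 'a) cat \<Rightarrow> 'a \<times> 'a \<Rightarrow> 'a \<times> 'a \<Rightarrow> bool" where
  "span_iso C p q \<longleftrightarrow> (\<exists>x. iso C x \<and> span_mor C p q x)"

text \<open>Pullbacks are determined only up to isomorphism, so the horizontal composite \<open>q \<cdot> p\<close> is
  the set of all composites, one for each choice of pullback. It is empty if \<open>p\<close> and \<open>q\<close> are not
  composable.\<close>

definition hcomps :: "('o, 'a) cat \<Rightarrow> 'a \<times> 'a \<Rightarrow> 'a \<times> 'a \<Rightarrow> ('a \<times> 'a) set" where
  "hcomps C q p = {(Comp C (fst p) t', Comp C (snd q) f') | t' f'.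
     pullback C (snd p) (fst q) t' f'}"

definition compatible :: "('o, 'a) cat \<Rightarrow> 'a set \<Rightarrow> (('a \<times> 'a) \<times> ('a \<times> 'a)) set \<Rightarrow> bool" where
  "compatible C S R \<longleftrightarrow>
     (\<forall>(p, q) \<in> R. p \<in> spans C S \<and> q \<in> spans C S \<and> sdom C p = sdom C q \<and> scod C p = scod C q) \<and>
     (\<forall>p \<in> spans C S. \<forall>q \<in> spans C S. span_iso C p q \<longrightarrow> (p, q) \<in> R) \<and>
     (\<forall>(p, q) \<in> R. \<forall>r \<in> spans C S.
        (\<forall>x \<in> hcomps C r p. \<forall>y \<in> hcomps C r q. (x, y) \<in> R) \<and>
        (\<forall>x \<in> hcomps C p r. \<forall>y \<in> hcomps C q r. (x, y) \<in> R))"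

definition generated_equiv :: "'x set \<Rightarrow> ('x \<times> 'x) set \<Rightarrow> ('x \<times> 'x) set" where
  "generated_equiv X R = \<Inter>{E. equiv X E \<and> R \<subseteq> E}"

text \<open>The category \<open>Span\<^sub>~(C, S)\<close> for a compatible equivalence relation \<open>R\<close>. The domain and
  codomain of a class are the common ones of its members; the composite of two classes is the class
  of all composites of their members.\<close>

definition span_quotient ::
    "('o, 'a) cat \<Rightarrow> 'a set \<Rightarrow> (('a \<times> 'a) \<times> ('a \<times> 'a)) set \<Rightarrow> ('o, ('a \<times> 'a) set) cat" where
  "span_quotient C S R =
     \<lparr>Obj = Obj C,
      Arr = spans C S // R,
      Dom = (\<lambda>P. the_elem (sdom C ` P)),
      Cod = (\<lambda>P. the_elem (scod C ` P)),
      Ident = (\<lambda>A. R `` {(Ident C A, Ident C A)}),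
      Comp = (\<lambda>Q P. R `` (\<Union>q \<in> Q. \<Union>p \<in> P. hcomps C q p))\<rparr>"

section \<open>Cospans and the category Sect\<close>

text \<open>A cospan \<open>\<langle>f, s\<rangle> : A \<rightarrow> B\<close> is likewise a raw pair, with \<open>A\<close> the domain of \<open>f\<close> and
  \<open>B\<close> the domain of \<open>s\<close>.\<close>

definition cospans :: "('o, 'a) cat \<Rightarrow> 'a set \<Rightarrow> ('a \<times> 'a) set" where
  "cospans C S = {(f, s). f \<in> Arr C \<and> s \<in> S \<and> Cod C f = Cod C s}"

definition cospan_mor :: "('o, 'a) cat \<Rightarrow> 'a \<times> 'a \<Rightarrow> 'a \<times> 'a \<Rightarrow> 'a \<Rightarrow> bool" where
  "cospan_mor C p q v \<longleftrightarrow> v \<in> hom C (Cod C (fst p)) (Cod C (fst q)) \<and>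
     Comp C v (fst p) = fst q \<and> Comp C v (snd p) = snd q"

definition cospan_le :: "('o, 'a) cat \<Rightarrow> 'a set \<Rightarrow> 'a \<times> 'a \<Rightarrow> 'a \<times> 'a \<Rightarrow> bool" where
  "cospan_le C S p q \<longleftrightarrow> (\<exists>v \<in> S. cospan_mor C p q v)"

text \<open>All spans representing \<open>pb \<langle>f, s\<rangle>\<close>, one for each choice of pullback.\<close>

definition pbs :: "('o, 'a) cat \<Rightarrow> 'a \<times> 'a \<Rightarrow> ('a \<times> 'a) set" where
  "pbs C p = {(s', f'). pullback C (fst p) (snd p) s' f'}"

definition approx_a :: "('o, 'a) cat \<Rightarrow> 'a set \<Rightarrow> (('a \<times> 'a) \<times> ('a \<times> 'a)) set" where
  "approx_a C S = \<Inter>{R. compatible C S R \<and>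
     (\<forall>p \<in> cospans C S. \<forall>q \<in> cospans C S. cospan_le C S p q \<longrightarrow>
        (\<forall>x \<in> pbs C p. \<forall>y \<in> pbs C q. (x, y) \<in> R))}"

definition sim_a :: "('o, 'a) cat \<Rightarrow> 'a set \<Rightarrow> (('a \<times> 'a) \<times> ('a \<times> 'a)) set" where
  "sim_a C S = generated_equiv (spans C S) (approx_a C S)"

definition Sect :: "('o, 'a) cat \<Rightarrow> 'a set \<Rightarrow> ('o, ('a \<times> 'a) set) cat" where
  "Sect C S = span_quotient C S (sim_a C S)"

definition Phi_a :: "('o, 'a) cat \<Rightarrow> 'a set \<Rightarrow> ('o, 'a, 'o, ('a \<times> 'a) set) ftor" where
  "Phi_a C S = \<lparr>omap = (\<lambda>A. A), amap = (\<lambda>f. sim_a C S `` {(Ident C (Dom C f), f)})\<rparr>"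

definition Psi_a :: "('o, 'a) cat \<Rightarrow> 'a set \<Rightarrow> ('o, 'a, 'o, ('a \<times> 'a) set) ftor" where
  "Psi_a C S = \<lparr>omap = (\<lambda>A. A), amap = (\<lambda>s. sim_a C S `` {(s, Ident C (Dom C s))})\<rparr>"

definition beck_chevalley ::
    "('o, 'a) cat \<Rightarrow> 'a set \<Rightarrow> ('p, 'b) cat \<Rightarrow>
     ('o, 'a, 'p, 'b) ftor \<Rightarrow> ('o, 'a, 'p, 'b) ftor \<Rightarrow> bool" where
  "beck_chevalley C S D F G \<longleftrightarrow>
     (\<forall>A \<in> Obj C. omap F A = omap G A) \<and>
     (\<forall>f s s' f'. s \<in> S \<and> pullback C f s s' f' \<longrightarrow>
        Comp D (amap G s) (amap F f) = Comp D (amap F f') (amap G s'))"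

end

(* On representatives H sends a span (s, f) to F f \<cdot> G s. The Beck-Chevalley property makes this
   assignment multiplicative for horizontal composition. Since G s \<cdot> F s = 1 forces F x \<cdot> G x = 1
   for isomorphisms x, it is constant on vertically isomorphic spans, and since
   G (v s) \<cdot> F (v f) = G s \<cdot> G v \<cdot> F v \<cdot> F f = G s \<cdot> F f, it identifies the pullbacks of
   \<preceq>-related cospans. Hence its kernel is a compatible equivalence relation that contains
   the generators of sim_a. Uniqueness holds because [s, f] = [1, f] \<cdot> [s, 1]. *)

theory Submission
  imports Defs
begin

section \<open>Pullbacks\<close>

context category
begin

text \<open>Endpoints are expressed through \<open>Dom\<close> and \<open>Cod\<close> instead of
  \<open>hom\<close>, so that composability becomes an equation between objects. The functors
  \<open>F\<close> and \<open>G\<close> are treated in the same way below.\<close>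

lemma Comp_Arr [simp]:
  assumes "f \<in> Arr C" "g \<in> Arr C" "Dom C g = Cod C f"
  shows "g \<cdot> f \<in> Arr C" "Dom C (g \<cdot> f) = Dom C f" "Cod C (g \<cdot> f) = Cod C g"
  using Comp_in_hom[of f "Dom C f" "Cod C f" g "Cod C g"] assms by (auto simp: hom_def)

lemma Comp_assoc_Arr:
  assumes "f \<in> Arr C" "g \<in> Arr C" "h \<in> Arr C" "Dom C g = Cod C f" "Dom C h = Cod C g"
  shows "h \<cdot> g \<cdot> f = h \<cdot> (g \<cdot> f)"
  using Comp_assoc[of f "Dom C f" "Cod C f" g "Cod C g" h "Cod C h"] assms by (auto simp: hom_def)

lemma Ident_Arr [simp]:
  assumes "A \<in> Obj C"
  shows "Ident C A \<in> Arr C" "Dom C (Ident C A) = A" "Cod C (Ident C A) = A"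
  using Ident_in_hom[OF assms] by (auto simp: hom_def)

lemma Comp_Ident [simp]:
  assumes "f \<in> Arr C"
  shows "Dom C f = A \<Longrightarrow> f \<cdot> Ident C A = f" "Cod C f = A \<Longrightarrow> Ident C A \<cdot> f = f"
  using Comp_Ident_right[of f "Dom C f" "Cod C f"] Comp_Ident_left[of f "Dom C f" "Cod C f"] assms
  by (auto simp: hom_def)

lemma Obj_Arr [simp]: "f \<in> Arr C \<Longrightarrow> Dom C f \<in> Obj C" "f \<in> Arr C \<Longrightarrow> Cod C f \<in> Obj C"
  by (simp_all add: Dom_in_Obj Cod_in_Obj)

lemma iso_Ident: "A \<in> Obj C \<Longrightarrow> iso C (Ident C A)"
  using Ident_in_hom[of A] by (auto simp: iso_def intro!: bexI[of _ "Ident C A"])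

lemma pullbackD:
  assumes "pullback C f s s' f'"
  shows "f \<in> Arr C" "s \<in> Arr C" "s' \<in> Arr C" "f' \<in> Arr C"
    "Cod C f = Cod C s" "Dom C s' = Dom C f'" "Cod C s' = Dom C f" "Cod C f' = Dom C s"
    "f \<cdot> s' = s \<cdot> f'"
  using assms by (auto simp: pullback_def)

lemma pullback_lift:
  assumes "pullback C f s s' f'" "x \<in> hom C Q (Dom C f)" "y \<in> hom C Q (Dom C s)" "f \<cdot> x = s \<cdot> y"
  obtains u where "u \<in> hom C Q (Dom C s')" "s' \<cdot> u = x" "f' \<cdot> u = y"
  using assms unfolding pullback_def by metis

text \<open>Uniqueness half of the universal property: \<open>u\<close> and \<open>v\<close> lift
  the same cone, so the projections are jointly monic.\<close>

lemma pullback_unique: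
  assumes "pullback C f s s' f'" "u \<in> hom C Q (Dom C s')" "v \<in> hom C Q (Dom C s')"
    "s' \<cdot> u = s' \<cdot> v" "f' \<cdot> u = f' \<cdot> v"
  shows "u = v"
proof -
  note pb = pullbackD[OF assms(1)]
  have x: "s' \<cdot> u \<in> hom C Q (Dom C f)" and y: "f' \<cdot> u \<in> hom C Q (Dom C s)"
    using assms(2) pb by (auto simp: hom_def)
  have "f \<cdot> (s' \<cdot> u) = s \<cdot> (f' \<cdot> u)"
    using assms(2) pb by (simp add: hom_def Comp_assoc_Arr[symmetric])
  then have "\<exists>!w. w \<in> hom C Q (Dom C s') \<and> s' \<cdot> w = s' \<cdot> u \<and> f' \<cdot> w = f' \<cdot> u"
    using assms(1) x y unfolding pullback_def by blast
  then show ?thesis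
    using assms(2-5) by metis
qed

text \<open>Splits the unique existence in the definition into existence of lifts and joint monicity
  of the projections.\<close>

lemma pullbackI:
  assumes "f \<in> Arr C" "s \<in> Arr C" "s' \<in> Arr C" "f' \<in> Arr C"
    "Cod C f = Cod C s" "Dom C s' = Dom C f'" "Cod C s' = Dom C f" "Cod C f' = Dom C s"
    "f \<cdot> s' = s \<cdot> f'"
    and lift: "\<And>Q x y. x \<in> hom C Q (Dom C f) \<Longrightarrow> y \<in> hom C Q (Dom C s) \<Longrightarrow> f \<cdot> x = s \<cdot> y \<Longrightarrow>
      \<exists>u \<in> hom C Q (Dom C s'). s' \<cdot> u = x \<and> f' \<cdot> u = y"
    and unique: "\<And>Q u v. u \<in> hom C Q (Dom C s') \<Longrightarrow> v \<in> hom C Q (Dom C s') \<Longrightarrow>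
      s' \<cdot> u = s' \<cdot> v \<Longrightarrow> f' \<cdot> u = f' \<cdot> v \<Longrightarrow> u = v"
  shows "pullback C f s s' f'"
proof -
  have "\<exists>!u. u \<in> hom C Q (Dom C s') \<and> s' \<cdot> u = x \<and> f' \<cdot> u = y"
    if "x \<in> hom C Q (Dom C f)" "y \<in> hom C Q (Dom C s)" "f \<cdot> x = s \<cdot> y" for Q x y
    using lift[OF that] unique by metis
  then show ?thesis
    using assms(1-9) unfolding pullback_def by blast
qed

lemma pullback_sym:
  assumes "pullback C f s s' f'"
  shows "pullback C s f f' s'"
proof -
  note pb = pullbackD[OF assms]
  show ?thesis
  proof (rule pullbackI)
    fix Q x y
    assume "x \<in> hom C Q (Dom C s)" "y \<in> hom C Q (Dom C f)" "s \<cdot> x = f \<cdot> y"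
    then show "\<exists>u \<in> hom C Q (Dom C f'). f' \<cdot> u = x \<and> s' \<cdot> u = y"
      using pullback_lift[OF assms, of y Q x] pb(6) by metis
  next
    fix Q u v
    assume "u \<in> hom C Q (Dom C f')" "v \<in> hom C Q (Dom C f')" "f' \<cdot> u = f' \<cdot> v" "s' \<cdot> u = s' \<cdot> v"
    then show "u = v"
      using pullback_unique[OF assms, of u Q v] pb(6) by simp
  qed (use pb in simp_all)
qed

text \<open>A cone over the outer square is lifted in two stages, first into the square over
  \<open>t\<close>, then into the square over \<open>u\<close>. Uniqueness descends through the same
  two stages.\<close>

lemma pullback_paste:
  assumes P: "pullback C f t t1 f1" and P': "pullback C f1 u u1 f2"
  shows "pullback C f (t \<cdot> u) (t1 \<cdot> u1) f2"
proof -
  note a = pullbackD[OF P] and b = pullbackD[OF P']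
  show ?thesis
  proof (rule pullbackI)
    have "f \<cdot> (t1 \<cdot> u1) = t \<cdot> f1 \<cdot> u1"
      using a b by (simp flip: Comp_assoc_Arr)
    also have "\<dots> = t \<cdot> u \<cdot> f2"
      using a b by (simp add: Comp_assoc_Arr)
    finally show "f \<cdot> (t1 \<cdot> u1) = t \<cdot> u \<cdot> f2" .
  next
    fix Q x y
    assume x: "x \<in> hom C Q (Dom C f)" and "y \<in> hom C Q (Dom C (t \<cdot> u))" and "f \<cdot> x = t \<cdot> u \<cdot> y"
    then have y: "y \<in> hom C Q (Dom C u)" and uy: "u \<cdot> y \<in> hom C Q (Dom C t)"
      and eq: "f \<cdot> x = t \<cdot> (u \<cdot> y)"
      using a b by (auto simp: hom_def Comp_assoc_Arr)
    obtain w where w: "w \<in> hom C Q (Dom C t1)" "t1 \<cdot> w = x" "f1 \<cdot> w = u \<cdot> y"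
      using pullback_lift[OF P x uy eq] .
    then have "w \<in> hom C Q (Dom C f1)"
      using a by simp
    then obtain z where z: "z \<in> hom C Q (Dom C u1)" "u1 \<cdot> z = w" "f2 \<cdot> z = y"
      using pullback_lift[OF P' _ y w(3)] by blast
    then have "t1 \<cdot> u1 \<cdot> z = x"
      using a b w by (simp add: hom_def Comp_assoc_Arr)
    then show "\<exists>z \<in> hom C Q (Dom C (t1 \<cdot> u1)). t1 \<cdot> u1 \<cdot> z = x \<and> f2 \<cdot> z = y"
      using z a b by auto
  next
    fix Q v w
    assume "v \<in> hom C Q (Dom C (t1 \<cdot> u1))" "w \<in> hom C Q (Dom C (t1 \<cdot> u1))"
      and e: "t1 \<cdot> u1 \<cdot> v = t1 \<cdot> u1 \<cdot> w" "f2 \<cdot> v = f2 \<cdot> w"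
    then have v: "v \<in> hom C Q (Dom C u1)" and w: "w \<in> hom C Q (Dom C u1)"
      using a b by simp_all
    have h: "u1 \<cdot> v \<in> hom C Q (Dom C t1)" "u1 \<cdot> w \<in> hom C Q (Dom C t1)"
      using v w a b by (auto simp: hom_def)
    have "t1 \<cdot> (u1 \<cdot> v) = t1 \<cdot> (u1 \<cdot> w)"
      using e v w a b by (simp add: hom_def Comp_assoc_Arr)
    \<comment> \<open>Commutativity of the second square trades \<open>f1\<close> for
      \<open>f2\<close>, where agreement of \<open>v\<close> and \<open>w\<close> is
      assumed.\<close>
    moreover have "f1 \<cdot> (u1 \<cdot> z) = u \<cdot> (f2 \<cdot> z)" if "z \<in> hom C Q (Dom C u1)" for z
      using that a b by (simp add: hom_def flip: Comp_assoc_Arr)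
    then have "f1 \<cdot> (u1 \<cdot> v) = f1 \<cdot> (u1 \<cdot> w)"
      using v w e(2) by simp
    ultimately have "u1 \<cdot> v = u1 \<cdot> w"
      using pullback_unique[OF P h] by blast
    then show "v = w"
      using pullback_unique[OF P' v w] e(2) by blast
  qed (use a b in simp_all)
qed

lemma pullback_Ident:
  assumes "f \<in> Arr C"
  shows "pullback C f (Ident C (Cod C f)) (Ident C (Dom C f)) f"
proof (rule pullbackI)
  fix Q x y
  assume x: "x \<in> hom C Q (Dom C f)" and y: "y \<in> hom C Q (Dom C (Ident C (Cod C f)))"
    and "f \<cdot> x = Ident C (Cod C f) \<cdot> y"
  moreover have "y \<in> hom C Q (Cod C f)"
    using y assms by simp
  ultimately have "f \<cdot> x = y"
    by (simp add: Comp_Ident_left)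
  then show "\<exists>u \<in> hom C Q (Dom C (Ident C (Dom C f))). Ident C (Dom C f) \<cdot> u = x \<and> f \<cdot> u = y"
    using x assms Comp_Ident_left[OF x] by auto
next
  fix Q u v
  assume "u \<in> hom C Q (Dom C (Ident C (Dom C f)))" "v \<in> hom C Q (Dom C (Ident C (Dom C f)))"
    "Ident C (Dom C f) \<cdot> u = Ident C (Dom C f) \<cdot> v"
  then show "u = v"
    using assms by (simp add: Comp_Ident_left)
qed (use assms in simp_all)

text \<open>Each square is lifted against the other. The two round trips have the same projections
  as an identity, hence equal it by joint monicity.\<close>

lemma pullback_iso:
  assumes P: "pullback C f s s1 f1" and P': "pullback C f s s2 f2"
  obtains x where "iso C x" "x \<in> hom C (Dom C s1) (Dom C s2)" "s2 \<cdot> x = s1" "f2 \<cdot> x = f1"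
proof -
  note a = pullbackD[OF P] and b = pullbackD[OF P']
  obtain x where x: "x \<in> hom C (Dom C s1) (Dom C s2)" "s2 \<cdot> x = s1" "f2 \<cdot> x = f1"
    using a by (auto intro: pullback_lift[OF P', of s1 "Dom C s1" f1] simp: hom_def)
  obtain y where y: "y \<in> hom C (Dom C s2) (Dom C s1)" "s1 \<cdot> y = s2" "f1 \<cdot> y = f2"
    using b by (auto intro: pullback_lift[OF P, of s2 "Dom C s2" f2] simp: hom_def)
  have id: "Ident C (Dom C s1) \<in> hom C (Dom C s1) (Dom C s1)"
      "Ident C (Dom C s2) \<in> hom C (Dom C s2) (Dom C s2)"
    using a b by (simp_all add: hom_def)
  have "s1 \<cdot> (y \<cdot> x) = s1" "f1 \<cdot> (y \<cdot> x) = f1"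
    using x y a by (simp_all add: hom_def flip: Comp_assoc_Arr)
  then have "y \<cdot> x = Ident C (Dom C s1)"
    using pullback_unique[OF P Comp_in_hom[OF x(1) y(1)] id(1)] a
    by (metis Comp_Ident(1))
  moreover have "s2 \<cdot> (x \<cdot> y) = s2" "f2 \<cdot> (x \<cdot> y) = f2"
    using x y b by (simp_all add: hom_def flip: Comp_assoc_Arr)
  then have "x \<cdot> y = Ident C (Dom C s2)"
    using pullback_unique[OF P' Comp_in_hom[OF y(1) x(1)] id(2)] b
    by (metis Comp_Ident(1))
  ultimately have "iso C x"
    using x(1) y(1) by (auto simp: iso_def hom_def)
  then show ?thesis
    using that x by blast
qed

end

section \<open>Quotients of the category of spans\<close>

context span_setting
begin

lemma S_Arr [simp]: "s \<in> S \<Longrightarrow> s \<in> Arr C"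
  using S_subset by auto

lemma Ident_in_S [simp]: "A \<in> Obj C \<Longrightarrow> Ident C A \<in> S"
  by (simp add: iso_in_S iso_Ident)

lemma Arr_spanI [simp]: "f \<in> Arr C \<Longrightarrow> (Ident C (Dom C f), f) \<in> spans C S"
  by (simp add: spans_def)

lemma S_spanI [simp]: "s \<in> S \<Longrightarrow> (s, Ident C (Dom C s)) \<in> spans C S"
  by (simp add: spans_def)

lemma hcompsI: "pullback C (snd p) (fst q) t' f' \<Longrightarrow> (fst p \<cdot> t', snd q \<cdot> f') \<in> hcomps C q p"
  by (auto simp: hcomps_def)

lemma hcompsE:
  assumes "x \<in> hcomps C q p"
  obtains t' f' where "x = (fst p \<cdot> t', snd q \<cdot> f')" "pullback C (snd p) (fst q) t' f'"
  using assms by (auto simp: hcomps_def)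

text \<open>The pullback behind a composite forces the middle objects to match, so the mere
  existence of \<open>x\<close> yields composability, the last conclusion.\<close>

lemma hcomps_spans:
  assumes p: "p \<in> spans C S" and q: "q \<in> spans C S" and x: "x \<in> hcomps C q p"
  shows "x \<in> spans C S" "sdom C x = sdom C p" "scod C x = scod C q" "scod C p = sdom C q"
proof -
  obtain t f where x': "x = (fst p \<cdot> t, snd q \<cdot> f)" and P: "pullback C (snd p) (fst q) t f"
    using x by (rule hcompsE)
  note a = pullbackD[OF P]
  have "t \<in> S"
    using pullback_in_S[OF _ P] q by (auto simp: spans_def)
  then show "x \<in> spans C S" "sdom C x = sdom C p" "scod C x = scod C q" "scod C p = sdom C q"
    using a p q by (auto simp: x' spans_def sdom_def scod_def Comp_in_S)
qed

lemma hcomps_nonempty: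
  assumes "p \<in> spans C S" "q \<in> spans C S" "scod C p = sdom C q"
  obtains x where "x \<in> hcomps C q p"
proof -
  obtain t' f' where "pullback C (snd p) (fst q) t' f'"
    using pullback_exists[of "fst q" "snd p"] assms by (auto simp: spans_def sdom_def scod_def)
  then show ?thesis
    using that hcompsI by blast
qed

text \<open>Two choices of pullback differ by a canonical isomorphism, and this comparison arrow is
  at once a morphism between the composite spans.\<close>

lemma hcomps_iso:
  assumes p: "p \<in> spans C S" and q: "q \<in> spans C S"
    and x: "x \<in> hcomps C q p" and y: "y \<in> hcomps C q p"
  shows "span_iso C x y"
proof -
  obtain t1 f1 where x': "x = (fst p \<cdot> t1, snd q \<cdot> f1)" and P1: "pullback C (snd p) (fst q) t1 f1"
    using x by (rule hcompsE)
  obtain t2 f2 where y': "y = (fst p \<cdot> t2, snd q \<cdot> f2)" and P2: "pullback C (snd p) (fst q) t2 f2"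
    using y by (rule hcompsE)
  obtain w where w: "iso C w" "w \<in> hom C (Dom C t1) (Dom C t2)" "t2 \<cdot> w = t1" "f2 \<cdot> w = f1"
    using pullback_iso[OF P1 P2] .
  have "fst p \<in> Arr C" "snd q \<in> Arr C" "Dom C (fst p) = Dom C (snd p)" "Dom C (snd q) = Dom C (fst q)"
    using p q by (auto simp: spans_def)
  moreover have "w \<in> Arr C" "Dom C w = Dom C t1" "Cod C w = Dom C t2"
    using w(2) by (auto simp: hom_def)
  moreover note pullbackD(3,4,6-8)[OF P1] pullbackD(3,4,6-8)[OF P2]
  ultimately have "span_mor C x y w"
    using w(3,4) by (simp add: x' y' span_mor_def hom_def Comp_assoc_Arr)
  then show ?thesis
    using w(1) by (auto simp: span_iso_def)
qed

lemma compatible_hcomps: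
  assumes "compatible C S R" "(p, q) \<in> R" "r \<in> spans C S"
  shows "x \<in> hcomps C r p \<Longrightarrow> y \<in> hcomps C r q \<Longrightarrow> (x, y) \<in> R"
    and "x \<in> hcomps C p r \<Longrightarrow> y \<in> hcomps C q r \<Longrightarrow> (x, y) \<in> R"
  using assms unfolding compatible_def by blast+

lemma span_iso_refl:
  assumes "p \<in> spans C S"
  shows "span_iso C p p"
proof -
  have "span_mor C p p (Ident C (Dom C (fst p)))"
    using assms Comp_Ident(1)[of "snd p"] by (auto simp: span_mor_def spans_def hom_def)
  then show ?thesis
    using assms iso_Ident[of "Dom C (fst p)"] by (auto simp: span_iso_def spans_def)
qed

text \<open>The trivial pullback square along an identity is one admissible choice, and it returns
  \<open>p\<close> itself rather than an isomorphic copy.\<close>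

lemma hcomps_Ident_right:
  assumes "p \<in> spans C S"
  shows "p \<in> hcomps C p (Ident C (sdom C p), Ident C (sdom C p))"
proof -
  have P: "pullback C (Ident C (Cod C (fst p))) (fst p) (fst p) (Ident C (Dom C (fst p)))"
    using pullback_sym[OF pullback_Ident, of "fst p"] assms by (auto simp: spans_def)
  have "p = (Ident C (sdom C p) \<cdot> fst p, snd p \<cdot> Ident C (Dom C (fst p)))"
    using assms Comp_Ident(1)[of "snd p"] by (auto simp: spans_def sdom_def)
  then show ?thesis
    using P unfolding hcomps_def sdom_def by auto
qed

lemma hcomps_Ident_left:
  assumes "p \<in> spans C S"
  shows "p \<in> hcomps C (Ident C (scod C p), Ident C (scod C p)) p"
proof -
  have P: "pullback C (snd p) (Ident C (Cod C (snd p))) (Ident C (Dom C (fst p))) (snd p)"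
    using pullback_Ident[of "snd p"] assms by (auto simp: spans_def)
  have "p = (fst p \<cdot> Ident C (Dom C (fst p)), Ident C (scod C p) \<cdot> snd p)"
    using assms by (auto simp: spans_def scod_def)
  then show ?thesis
    using P unfolding hcomps_def scod_def by auto
qed

text \<open>Every span is an arrow of \<open>C\<close> after a reversed arrow of \<open>S\<close>,
  again by a trivial pullback. This factorization forces the uniqueness of the induced
  functor.\<close>

lemma hcomps_factor:
  assumes "(s, f) \<in> spans C S"
  shows "(s, f) \<in> hcomps C (Ident C (Dom C f), f) (s, Ident C (Dom C s))"
proof -
  have "pullback C (Ident C (Dom C s)) (Ident C (Dom C f)) (Ident C (Dom C s)) (Ident C (Dom C f))"
    using pullback_Ident[of "Ident C (Dom C s)"] assms by (simp add: spans_def)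
  moreover have "(s, f) = (s \<cdot> Ident C (Dom C s), f \<cdot> Ident C (Dom C f))"
    using assms by (auto simp: spans_def)
  ultimately show ?thesis
    unfolding hcomps_def by auto
qed

text \<open>Three pullbacks, pasted in two ways, make a single span \<open>z\<close> a composite
  under both bracketings. Sharing \<open>z\<close> gives associativity in the quotient.\<close>

lemma hcomps_assoc:
  assumes p: "p \<in> spans C S" and q: "q \<in> spans C S" and r: "r \<in> spans C S"
    and "scod C p = sdom C q" "scod C q = sdom C r"
  obtains x y z where "x \<in> hcomps C q p" "y \<in> hcomps C r q" "z \<in> hcomps C r x" "z \<in> hcomps C y p"
proof -
  have S: "fst q \<in> S" "fst r \<in> S"
    using q r by (auto simp: spans_def)
  obtain t1 f1 where P1: "pullback C (snd p) (fst q) t1 f1"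
    using pullback_exists[of "fst q" "snd p"] assms by (auto simp: spans_def sdom_def scod_def)
  obtain u1 g1 where P2: "pullback C (snd q) (fst r) u1 g1"
    using pullback_exists[of "fst r" "snd q"] assms by (auto simp: spans_def sdom_def scod_def)
  have u1: "u1 \<in> S"
    using pullback_in_S[OF S(2) P2] .
  have "Cod C f1 = Cod C u1"
    using pullbackD[OF P1] pullbackD[OF P2] q by (auto simp: spans_def)
  \<comment> \<open>The third pullback joins the first two over the apex of \<open>q\<close>; it
    exists because \<open>u1\<close> lies in \<open>S\<close>.\<close>
  then obtain u2 f2 where P3: "pullback C f1 u1 u2 f2"
    using pullback_exists[OF u1, of f1] pullbackD[OF P1] by auto
  note a = pullbackD[OF P1] and b = pullbackD[OF P2] and c = pullbackD[OF P3]
  have "pullback C (snd p) (fst q \<cdot> u1) (t1 \<cdot> u2) f2"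
    using pullback_paste[OF P1 P3] .
  \<comment> \<open>Symmetry turns the pasting lemma sideways, so that it stacks the squares in the
    other direction.\<close>
  moreover have "pullback C (snd q \<cdot> f1) (fst r) u2 (g1 \<cdot> f2)"
    using pullback_sym[OF pullback_paste[OF pullback_sym[OF P2] pullback_sym[OF P3]]] .
  moreover have "(fst p \<cdot> (t1 \<cdot> u2), snd r \<cdot> g1 \<cdot> f2) = (fst p \<cdot> t1 \<cdot> u2, snd r \<cdot> (g1 \<cdot> f2))"
    using a b c p r by (auto simp: spans_def Comp_assoc_Arr)
  ultimately show ?thesis
    using that hcompsI[OF P1] hcompsI[OF P2]
      hcompsI[of "(fst p \<cdot> t1, snd q \<cdot> f1)" r u2 "g1 \<cdot> f2"]
      hcompsI[of p "(fst q \<cdot> u1, snd r \<cdot> g1)" "t1 \<cdot> u2" f2]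
    by (metis fst_conv snd_conv)
qed

end

section \<open>The quotient category of a compatible equivalence relation\<close>

locale span_congruence = span_setting C S
  for C :: "('o, 'a) cat" (structure) and S :: "'a set" +
  fixes R :: "(('a \<times> 'a) \<times> ('a \<times> 'a)) set"
  assumes equiv: "equiv (spans C S) R"
    and compatible: "compatible C S R"
begin

lemma R_spans:
  assumes "(p, q) \<in> R"
  shows "p \<in> spans C S" "q \<in> spans C S" "sdom C p = sdom C q" "scod C p = scod C q"
  using compatible assms by (auto simp: compatible_def)

text \<open>The arguments are replaced one at a time, passing through a composite \<open>z\<close>
  of \<open>q\<close> and \<open>p'\<close>. Such a \<open>z\<close> exists because related spans
  have equal endpoints.\<close>

lemma hcomps_R:
  assumes p: "(p, p') \<in> R" and q: "(q, q') \<in> R"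
    and x: "x \<in> hcomps C q p" and y: "y \<in> hcomps C q' p'"
  shows "(x, y) \<in> R"
proof -
  have "scod C p = sdom C q"
    using hcomps_spans(4)[OF _ _ x] R_spans[OF p] R_spans[OF q] by simp
  then obtain z where z: "z \<in> hcomps C q p'"
    using hcomps_nonempty[of p' q] R_spans[OF p] R_spans[OF q] by auto
  have "(x, z) \<in> R"
    using compatible_hcomps(1)[OF compatible p R_spans(1)[OF q] x z] .
  moreover have "(z, y) \<in> R"
    using compatible_hcomps(2)[OF compatible q R_spans(2)[OF p] z y] .
  ultimately show ?thesis
    using equiv by (meson equivE transE)
qed

abbreviation cls :: "'a \<times> 'a \<Rightarrow> ('a \<times> 'a) set" where
  "cls p \<equiv> R `` {p}"

abbreviation Q :: "('o, ('a \<times> 'a) set) cat" where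
  "Q \<equiv> span_quotient C S R"

lemma cls_self: "p \<in> spans C S \<Longrightarrow> p \<in> cls p"
  by (rule equiv_class_self[OF equiv])

text \<open>\<open>the_elem\<close> is meaningful here because \<open>sdom\<close> is constant on a
  class.\<close>

lemma Dom_cls: "p \<in> spans C S \<Longrightarrow> Dom Q (cls p) = sdom C p"
  using cls_self[of p] the_elem_image_unique[of "cls p" "sdom C" "sdom C p"]
  by (fastforce simp: span_quotient_def dest: R_spans(3))

lemma Cod_cls: "p \<in> spans C S \<Longrightarrow> Cod Q (cls p) = scod C p"
  using cls_self[of p] the_elem_image_unique[of "cls p" "scod C" "scod C p"]
  by (fastforce simp: span_quotient_def dest: R_spans(4))

lemma cls_in_hom: "p \<in> spans C S \<Longrightarrow> cls p \<in> hom Q (sdom C p) (scod C p)"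
  using Dom_cls[of p] Cod_cls[of p] by (auto simp: hom_def span_quotient_def intro: quotientI)

lemma hom_clsE:
  assumes "P \<in> hom Q A B"
  obtains p where "p \<in> spans C S" "P = cls p" "sdom C p = A" "scod C p = B"
proof -
  have "P \<in> spans C S // R"
    using assms by (simp add: hom_def span_quotient_def)
  then obtain p where p: "p \<in> spans C S" "P = cls p"
    by (auto elim: quotientE)
  then show ?thesis
    using that assms Dom_cls[of p] Cod_cls[of p] by (auto simp: hom_def)
qed

text \<open>By \<open>hcomps_R\<close>, all composites of members of the two classes, for all
  choices of pullback, fall into one class, so any single \<open>x\<close> may represent it.\<close>

lemma Comp_cls:
  assumes "p \<in> spans C S" "q \<in> spans C S" "x \<in> hcomps C q p"
  shows "Comp Q (cls q) (cls p) = cls x"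
proof -
  have "cls y = cls x" if "y \<in> hcomps C q' p'" "(q, q') \<in> R" "(p, p') \<in> R" for y p' q'
    using hcomps_R[OF that(3,2) assms(3) that(1)] equiv by (simp add: equiv_class_eq_iff)
  moreover have "p \<in> cls p" "q \<in> cls q"
    using assms cls_self by auto
  ultimately have "R `` (\<Union>q' \<in> cls q. \<Union>p' \<in> cls p. hcomps C q' p') = cls x"
    using assms(3) by blast
  then show ?thesis
    by (simp add: span_quotient_def)
qed

lemma Ident_cls: "Ident Q A = cls (Ident C A, Ident C A)"
  by (simp add: span_quotient_def)

lemma Obj_Q: "Obj Q = Obj C"
  by (simp add: span_quotient_def)

lemma sdom_Obj: "p \<in> spans C S \<Longrightarrow> sdom C p \<in> Obj C"
  and scod_Obj: "p \<in> spans C S \<Longrightarrow> scod C p \<in> Obj C"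
  by (auto simp: spans_def sdom_def scod_def)

lemma Ident_span: "A \<in> Obj C \<Longrightarrow> (Ident C A, Ident C A) \<in> spans C S"
  by (simp add: spans_def)

lemma category_Q: "category Q"
proof
  fix P assume "P \<in> Arr Q"
  then have "P \<in> hom Q (Dom Q P) (Cod Q P)"
    by (simp add: hom_def)
  then obtain p where "p \<in> spans C S" "sdom C p = Dom Q P" "scod C p = Cod Q P"
    using hom_clsE by blast
  then show "Dom Q P \<in> Obj Q" "Cod Q P \<in> Obj Q"
    using sdom_Obj[of p] scod_Obj[of p] by (simp_all add: Obj_Q)
next
  fix A assume "A \<in> Obj Q"
  then show "Ident Q A \<in> hom Q A A"
    using cls_in_hom[OF Ident_span, of A] by (simp add: Ident_cls Obj_Q sdom_def scod_def)
next
  fix P P' X Y Z assume "P \<in> hom Q X Y" "P' \<in> hom Q Y Z"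
  then obtain p q where p: "p \<in> spans C S" "P = cls p" "sdom C p = X" "scod C p = Y"
    and q: "q \<in> spans C S" "P' = cls q" "sdom C q = Y" "scod C q = Z"
    by (metis hom_clsE)
  obtain x where x: "x \<in> hcomps C q p"
    using hcomps_nonempty[of p q] p q by auto
  then show "Comp Q P' P \<in> hom Q X Z"
    using Comp_cls[OF _ _ x] cls_in_hom[of x] hcomps_spans[OF _ _ x] p q by simp
next
  fix P X Y assume "P \<in> hom Q X Y"
  then obtain p where p: "p \<in> spans C S" "P = cls p" "sdom C p = X" "scod C p = Y"
    by (rule hom_clsE)
  show "Comp Q P (Ident Q X) = P"
    using Comp_cls[OF Ident_span p(1) hcomps_Ident_right[OF p(1), unfolded p(3)]] p sdom_Obj[of p]
    by (simp add: Ident_cls)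
  show "Comp Q (Ident Q Y) P = P"
    using Comp_cls[OF p(1) Ident_span hcomps_Ident_left[OF p(1), unfolded p(4)]] p scod_Obj[of p]
    by (simp add: Ident_cls)
next
  fix P P' P'' W X Y Z assume "P \<in> hom Q W X" "P' \<in> hom Q X Y" "P'' \<in> hom Q Y Z"
  then obtain p q r where p: "p \<in> spans C S" "P = cls p" "scod C p = X"
    and q: "q \<in> spans C S" "P' = cls q" "sdom C q = X" "scod C q = Y"
    and r: "r \<in> spans C S" "P'' = cls r" "sdom C r = Y"
    by (metis hom_clsE)
  \<comment> \<open>The class of \<open>z\<close> is the value of both bracketings.\<close>
  obtain x y z where
    x: "x \<in> hcomps C q p" and y: "y \<in> hcomps C r q"
    and z: "z \<in> hcomps C r x" "z \<in> hcomps C y p"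
    using hcomps_assoc[of p q r] p q r by metis
  have "x \<in> spans C S" "y \<in> spans C S"
    using hcomps_spans(1)[OF _ _ x] hcomps_spans(1)[OF _ _ y] p q r by auto
  then show "Comp Q (Comp Q P'' P') P = Comp Q P'' (Comp Q P' P)"
    using x y z p q r by (simp add: Comp_cls)
qed

end

section \<open>Generated congruences\<close>

lemma generated_equiv_least: "equiv X E \<Longrightarrow> R \<subseteq> E \<Longrightarrow> generated_equiv X R \<subseteq> E"
  by (auto simp: generated_equiv_def)

lemma generated_equiv_contains: "R \<subseteq> generated_equiv X R"
  by (auto simp: generated_equiv_def)

text \<open>Equivalences on \<open>X\<close> are closed under nonempty intersections. The assumption
  on \<open>R\<close> puts \<open>X \<times> X\<close> into the family, so the intersection stays
  inside it.\<close>

lemma equiv_generated_equiv: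
  assumes "R \<subseteq> X \<times> X"
  shows "equiv X (generated_equiv X R)"
proof (rule equivI)
  have "equiv X (X \<times> X)"
    by (auto simp: equiv_def refl_on_def sym_def trans_def)
  then show "generated_equiv X R \<subseteq> X \<times> X"
    using assms by (rule generated_equiv_least)
  show "refl_on X (generated_equiv X R)"
    by (auto simp: generated_equiv_def refl_on_def equiv_def)
  show "sym (generated_equiv X R)"
    by (auto simp: generated_equiv_def sym_def equiv_def)
  show "trans (generated_equiv X R)"
    unfolding generated_equiv_def trans_def equiv_def by blast
qed

section \<open>Compatibility of \<open>approx_a\<close> and \<open>sim_a\<close>\<close>

context span_setting
begin

text \<open>The largest relation that respects endpoints. Being a compatible equivalence, it bounds
  the generated relations from above, and their endpoint conditions are obtained from this
  bound.\<close>

definition parallel :: "(('a \<times> 'a) \<times> ('a \<times> 'a)) set" where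
  "parallel = {(p, q). p \<in> spans C S \<and> q \<in> spans C S \<and> sdom C p = sdom C q \<and> scod C p = scod C q}"

lemma equiv_parallel: "equiv (spans C S) parallel"
  by (auto simp: parallel_def equiv_def refl_on_def sym_def trans_def)

lemma span_iso_parallel:
  assumes "p \<in> spans C S" "q \<in> spans C S" "span_iso C p q"
  shows "(p, q) \<in> parallel"
proof -
  obtain x where x: "x \<in> hom C (Dom C (fst p)) (Dom C (fst q))"
      "fst q \<cdot> x = fst p" "snd q \<cdot> x = snd p"
    using assms(3) by (auto simp: span_iso_def span_mor_def)
  have "Cod C (fst q \<cdot> x) = Cod C (fst q)" "Cod C (snd q \<cdot> x) = Cod C (snd q)"
    using x(1) assms(2) by (auto simp: hom_def spans_def)
  then show ?thesis
    using assms(1,2) x by (simp add: parallel_def sdom_def scod_def)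
qed

lemma compatible_parallel: "compatible C S parallel"
proof -
  have "(x, y) \<in> parallel"
    if "(p, p') \<in> parallel" "(q, q') \<in> parallel" "x \<in> hcomps C q p" "y \<in> hcomps C q' p'"
    for p p' q q' x y
    using that hcomps_spans[of p q x] hcomps_spans[of p' q' y] by (simp add: parallel_def)
  moreover have "(r, r) \<in> parallel" if "r \<in> spans C S" for r
    using that by (simp add: parallel_def)
  moreover have "\<forall>(p, q) \<in> parallel. p \<in> spans C S \<and> q \<in> spans C S \<and> sdom C p = sdom C q \<and>
      scod C p = scod C q"
    by (auto simp: parallel_def)
  ultimately show ?thesis
    using span_iso_parallel unfolding compatible_def by blast
qed

text \<open>Preservation by composition is the substantial clause. The pairs preserved by it form an
  equivalence containing \<open>R\<close>, so by minimality they exhaust the generated one.\<close>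

lemma compatible_generated_equiv:
  assumes R: "compatible C S R"
  shows "compatible C S (generated_equiv (spans C S) R)" (is "compatible C S ?E")
proof -
  have sub: "R \<subseteq> parallel"
    using R by (fastforce simp: compatible_def parallel_def)
  then have "R \<subseteq> spans C S \<times> spans C S"
    by (auto simp: parallel_def)
  then have E: "equiv (spans C S) ?E"
    by (rule equiv_generated_equiv)
  have Epar: "?E \<subseteq> parallel"
    using equiv_parallel sub by (rule generated_equiv_least)
  have RE: "R \<subseteq> ?E"
    by (rule generated_equiv_contains)
  have iso: "(p, q) \<in> ?E" if "p \<in> spans C S" "q \<in> spans C S" "span_iso C p q" for p q
    using that R RE by (auto simp: compatible_def)
  \<comment> \<open>Composites are only required to lie in \<open>?E\<close>, not in
    \<open>K\<close> itself, so the condition is explicit and not recursive.\<close>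
  define K where "K = {(p, q) \<in> ?E. \<forall>r \<in> spans C S.
      (\<forall>x \<in> hcomps C r p. \<forall>y \<in> hcomps C r q. (x, y) \<in> ?E) \<and>
      (\<forall>x \<in> hcomps C p r. \<forall>y \<in> hcomps C q r. (x, y) \<in> ?E)}"
  have "equiv (spans C S) K"
  proof (rule equivI)
    show "K \<subseteq> spans C S \<times> spans C S"
      using Epar by (auto simp: K_def parallel_def)
    show "refl_on (spans C S) K"
    proof (rule refl_onI)
      fix p assume p: "p \<in> spans C S"
      have "(p, p) \<in> ?E"
        using p span_iso_refl iso by simp
      \<comment> \<open>Even reflexivity needs an argument, since one pair of spans has many
        composites; these are isomorphic.\<close>
      moreover have "(x, y) \<in> ?E" if "q \<in> spans C S" "r \<in> spans C S"
          "x \<in> hcomps C r q" "y \<in> hcomps C r q" for q r x y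
        using that iso hcomps_iso[OF that] hcomps_spans(1) by blast
      ultimately show "(p, p) \<in> K"
        using p by (auto simp: K_def)
    qed
    show "sym K"
      using E unfolding K_def equiv_def sym_def by blast
    show "trans K"
    proof (rule transI)
      fix p q w assume pq: "(p, q) \<in> K" and qw: "(q, w) \<in> K"
      have tr: "(a, c) \<in> ?E" if "(a, b) \<in> ?E" "(b, c) \<in> ?E" for a b c
        using E that by (meson equivE transE)
      have span: "p \<in> spans C S" "q \<in> spans C S" "scod C p = scod C q" "sdom C p = sdom C q"
        using pq Epar by (auto simp: K_def parallel_def)
      have "(p, w) \<in> ?E"
        using pq qw tr[of p q w] by (simp add: K_def)
      moreover have "(x, y) \<in> ?E"
        if r: "r \<in> spans C S" and x: "x \<in> hcomps C r p" and y: "y \<in> hcomps C r w" for r x y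
      proof -
        \<comment> \<open>Transitivity passes through a composite with the middle span
          \<open>q\<close>. It exists since \<open>q\<close> has the endpoints of \<open>p\<close>,
          and \<open>p\<close> is composable with \<open>r\<close>.\<close>
        obtain z where "z \<in> hcomps C r q"
          using hcomps_nonempty[of q r] hcomps_spans(4)[OF _ r x] span r by auto
        then show ?thesis
          using pq qw r x y tr[of x z y] by (auto simp: K_def)
      qed
      moreover have "(x, y) \<in> ?E"
        if r: "r \<in> spans C S" and x: "x \<in> hcomps C p r" and y: "y \<in> hcomps C w r" for r x y
      proof -
        obtain z where "z \<in> hcomps C q r"
          using hcomps_nonempty[of r q] hcomps_spans(4)[OF r _ x] span r by auto
        then show ?thesis
          using pq qw r x y tr[of x z y] by (auto simp: K_def)
      qed
      ultimately show "(p, w) \<in> K"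
        by (auto simp: K_def)
    qed
  qed
  moreover have "R \<subseteq> K"
    using R RE by (fastforce simp: K_def compatible_def)
  ultimately have "?E \<subseteq> K"
    by (rule generated_equiv_least)
  moreover have "\<forall>(p, q) \<in> ?E. p \<in> spans C S \<and> q \<in> spans C S \<and> sdom C p = sdom C q \<and>
      scod C p = scod C q"
    using Epar by (auto simp: parallel_def)
  ultimately show ?thesis
    using iso unfolding compatible_def K_def by blast
qed

lemma pbs_spans:
  assumes "p \<in> cospans C S" "x \<in> pbs C p"
  shows "x \<in> spans C S" "sdom C x = Dom C (fst p)" "scod C x = Dom C (snd p)"
proof -
  have P: "pullback C (fst p) (snd p) (fst x) (snd x)"
    using assms(2) by (auto simp: pbs_def)
  then show "x \<in> spans C S" "sdom C x = Dom C (fst p)" "scod C x = Dom C (snd p)"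
    using pullbackD[OF P] pullback_in_S[OF _ P] assms(1)
    by (auto simp: spans_def cospans_def sdom_def scod_def split: prod.splits)
qed

text \<open>Composing both legs of a cospan with \<open>v\<close> keeps their domains, and these are
  the endpoints of the pullback span.\<close>

lemma cospan_le_parallel:
  assumes "p \<in> cospans C S" "q \<in> cospans C S" "cospan_le C S p q" "x \<in> pbs C p" "y \<in> pbs C q"
  shows "(x, y) \<in> parallel"
proof -
  obtain v where v: "v \<in> hom C (Cod C (fst p)) (Cod C (fst q))" "v \<cdot> fst p = fst q" "v \<cdot> snd p = snd q"
    using assms(3) by (auto simp: cospan_le_def cospan_mor_def)
  have "fst p \<in> Arr C" "snd p \<in> Arr C" "Cod C (fst p) = Cod C (snd p)"
    using assms(1) by (auto simp: cospans_def)
  then have "Dom C (v \<cdot> fst p) = Dom C (fst p)" "Dom C (v \<cdot> snd p) = Dom C (snd p)"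
    using v(1) by (simp_all add: hom_def)
  then show ?thesis
    using pbs_spans[OF assms(1,4)] pbs_spans[OF assms(2,5)] v by (simp add: parallel_def)
qed

lemma approx_a_least:
  assumes "compatible C S R"
    and "\<And>p q x y. p \<in> cospans C S \<Longrightarrow> q \<in> cospans C S \<Longrightarrow> cospan_le C S p q \<Longrightarrow>
      x \<in> pbs C p \<Longrightarrow> y \<in> pbs C q \<Longrightarrow> (x, y) \<in> R"
  shows "approx_a C S \<subseteq> R"
  unfolding approx_a_def using assms by (intro Inter_lower) blast

text \<open>The isomorphism and composition clauses survive arbitrary intersections. The endpoint
  clause is a bound from above and needs some member of the family, here
  \<open>parallel\<close>.\<close>

lemma compatible_approx_a: "compatible C S (approx_a C S)"
proof -
  have "approx_a C S \<subseteq> parallel"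
    using compatible_parallel cospan_le_parallel by (rule approx_a_least)
  then have "\<forall>(p, q) \<in> approx_a C S. p \<in> spans C S \<and> q \<in> spans C S \<and> sdom C p = sdom C q \<and>
      scod C p = scod C q"
    by (auto simp: parallel_def)
  moreover have "\<forall>p \<in> spans C S. \<forall>q \<in> spans C S. span_iso C p q \<longrightarrow> (p, q) \<in> approx_a C S"
    unfolding approx_a_def compatible_def by blast
  moreover have "\<forall>(p, q) \<in> approx_a C S. \<forall>r \<in> spans C S.
        (\<forall>x \<in> hcomps C r p. \<forall>y \<in> hcomps C r q. (x, y) \<in> approx_a C S) \<and>
        (\<forall>x \<in> hcomps C p r. \<forall>y \<in> hcomps C q r. (x, y) \<in> approx_a C S)"
    unfolding approx_a_def using compatible_hcomps by blast
  ultimately show ?thesis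
    unfolding compatible_def by blast
qed

lemma span_congruence_sim_a: "span_congruence C S (sim_a C S)"
proof
  have "approx_a C S \<subseteq> spans C S \<times> spans C S"
    using compatible_approx_a by (fastforce simp: compatible_def)
  then show "equiv (spans C S) (sim_a C S)"
    unfolding sim_a_def by (rule equiv_generated_equiv)
  show "compatible C S (sim_a C S)"
    unfolding sim_a_def using compatible_approx_a by (rule compatible_generated_equiv)
qed

end

sublocale span_setting \<subseteq> sect: span_congruence C S "sim_a C S"
  by (rule span_congruence_sim_a)

section \<open>The universal property\<close>

locale sect_pair = span_setting C S + tgt: category D + F: cat_functor C D F
  for C :: "('o, 'a) cat" (structure) and S :: "'a set" and D :: "('p, 'b) cat"
    and F :: "('o, 'a, 'p, 'b) ftor" +
  fixes G :: "('o, 'a, 'p, 'b) ftor"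
  assumes G: "cat_functor (op_cat (wide_subcat C S)) D G"
    and BC: "beck_chevalley C S D F G"
    and section_eq: "\<forall>s \<in> S. Comp D (amap G s) (amap F s) = Ident D (omap F (Dom C s))"
begin

abbreviation DComp (infixl "\<odot>" 70) where "g \<odot> f \<equiv> Comp D g f"

lemma F_arr [simp]:
  assumes "f \<in> Arr C"
  shows "amap F f \<in> Arr D" "Dom D (amap F f) = omap F (Dom C f)" "Cod D (amap F f) = omap F (Cod C f)"
  using F.amap_in_hom[of f "Dom C f" "Cod C f"] assms by (auto simp: hom_def)

lemma F_Comp:
  assumes "f \<in> Arr C" "g \<in> Arr C" "Dom C g = Cod C f"
  shows "amap F (g \<cdot> f) = amap F g \<odot> amap F f"
  using F.amap_Comp[of f "Dom C f" "Cod C f" g "Cod C g"] assms by (auto simp: hom_def)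

lemma G_omap: "A \<in> Obj C \<Longrightarrow> omap G A = omap F A"
  using BC by (simp add: beck_chevalley_def)

lemma G_arr [simp]:
  assumes "s \<in> S"
  shows "amap G s \<in> Arr D" "Dom D (amap G s) = omap F (Cod C s)" "Cod D (amap G s) = omap F (Dom C s)"
  using cat_functor.amap_in_hom[OF G, of s "Cod C s" "Dom C s"] assms
  by (auto simp: hom_def op_cat_def wide_subcat_def G_omap)

lemma G_Comp:
  assumes "s \<in> S" "t \<in> S" "Dom C t = Cod C s"
  shows "amap G (t \<cdot> s) = amap G s \<odot> amap G t"
  using cat_functor.amap_Comp[OF G, of t "Cod C t" "Dom C t" s "Dom C s"] assms
  by (auto simp: hom_def op_cat_def wide_subcat_def)

lemma G_Ident: "A \<in> Obj C \<Longrightarrow> amap G (Ident C A) = Ident D (omap F A)"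
  using cat_functor.amap_Ident[OF G, of A] by (simp add: op_cat_def wide_subcat_def G_omap)

lemma G_F: "s \<in> S \<Longrightarrow> amap G s \<odot> amap F s = Ident D (omap F (Dom C s))"
  using section_eq by blast

lemma Beck_Chevalley:
  "s \<in> S \<Longrightarrow> pullback C f s s' f' \<Longrightarrow> amap G s \<odot> amap F f = amap F f' \<odot> amap G s'"
  using BC by (auto simp: beck_chevalley_def)

text \<open>For \<open>y\<close> inverse to \<open>x\<close>, \<open>amap G x\<close> is a left
  inverse and \<open>amap F y\<close> a right inverse of \<open>amap F x\<close>. Hence the two
  agree.\<close>

lemma F_G_iso:
  assumes "iso C x"
  shows "amap F x \<odot> amap G x = Ident D (omap F (Cod C x))"
proof -
  have x: "x \<in> S" "x \<in> Arr C"
    using assms iso_in_S by auto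
  obtain y where y: "y \<in> Arr C" "Dom C y = Cod C x" "Cod C y = Dom C x" "x \<cdot> y = Ident C (Cod C x)"
    using assms by (auto simp: iso_def hom_def)
  have xy: "amap F x \<odot> amap F y = Ident D (omap F (Cod C x))"
    using F_Comp[of y x] F.amap_Ident[of "Cod C x"] x y by simp
  have "amap G x = amap G x \<odot> (amap F x \<odot> amap F y)"
    using x y xy tgt.Comp_Ident(1)[of "amap G x"] by simp
  also have "\<dots> = Ident D (omap F (Dom C x)) \<odot> amap F y"
    using x y G_F[of x] tgt.Comp_assoc_Arr[of "amap F y" "amap F x" "amap G x"] by simp
  also have "\<dots> = amap F y"
    using x y tgt.Comp_Ident(2)[of "amap F y"] by simp
  finally show ?thesis
    using xy by simp
qed

section \<open>The value of a span in \<open>D\<close> and its invariance\<close>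

definition val :: "'a \<times> 'a \<Rightarrow> 'b" where
  "val p = amap F (snd p) \<odot> amap G (fst p)"

lemma val_in_hom:
  "p \<in> spans C S \<Longrightarrow> val p \<in> hom D (omap F (sdom C p)) (omap F (scod C p))"
  by (auto simp: val_def spans_def sdom_def scod_def hom_def)

text \<open>The isomorphism \<open>x\<close> contributes only an inner factor
  \<open>amap F x \<odot> amap G x\<close>, which is an identity by \<open>F_G_iso\<close>.\<close>

lemma val_span_iso:
  assumes p: "p \<in> spans C S" and q: "q \<in> spans C S" and iso: "span_iso C p q"
  shows "val p = val q"
proof -
  obtain x where x: "iso C x" "x \<in> hom C (Dom C (fst p)) (Dom C (fst q))"
      "fst q \<cdot> x = fst p" "snd q \<cdot> x = snd p"
    using iso by (auto simp: span_iso_def span_mor_def)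
  define s f where "s = fst q" and "f = snd q"
  have s: "s \<in> S" "f \<in> Arr C" "Dom C f = Dom C s"
    using q by (auto simp: s_def f_def spans_def)
  have x': "x \<in> S" "x \<in> Arr C" "Cod C x = Dom C s"
    using x iso_in_S by (auto simp: hom_def s_def)
  have "val p = (amap F f \<odot> amap F x) \<odot> (amap G x \<odot> amap G s)"
    using x(3,4) F_Comp[of x f] G_Comp[of x s] s x' by (simp add: val_def flip: s_def f_def)
  also have "\<dots> = amap F f \<odot> ((amap F x \<odot> amap G x) \<odot> amap G s)"
    using s x' by (simp add: tgt.Comp_assoc_Arr)
  also have "\<dots> = val q"
    using F_G_iso[OF x(1)] s x' tgt.Comp_Ident(2)[of "amap G s"] by (simp add: val_def s_def f_def)
  finally show ?thesis .
qed

text \<open>After expansion by functoriality, the two inner factors form one side of the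
  Beck-Chevalley equation for the pullback that defines the composite; the other side gives the
  product of the values.\<close>

lemma val_hcomps:
  assumes p: "p \<in> spans C S" and q: "q \<in> spans C S" and x: "x \<in> hcomps C q p"
  shows "val x = val q \<odot> val p"
proof -
  obtain t' f' where x': "x = (fst p \<cdot> t', snd q \<cdot> f')" and P: "pullback C (snd p) (fst q) t' f'"
    using x by (rule hcompsE)
  have S: "fst p \<in> S" "fst q \<in> S" "snd p \<in> Arr C" "snd q \<in> Arr C"
      "Dom C (fst p) = Dom C (snd p)" "Dom C (fst q) = Dom C (snd q)"
    using p q by (auto simp: spans_def)
  have t': "t' \<in> S"
    using pullback_in_S[OF S(2) P] .
  note a = pullbackD[OF P]
  have "val x = (amap F (snd q) \<odot> amap F f') \<odot> (amap G t' \<odot> amap G (fst p))"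
    using F_Comp[of f' "snd q"] G_Comp[of t' "fst p"] a S t' by (simp add: val_def x')
  also have "\<dots> = amap F (snd q) \<odot> ((amap F f' \<odot> amap G t') \<odot> amap G (fst p))"
    using a S t' by (simp add: tgt.Comp_assoc_Arr)
  also have "amap F f' \<odot> amap G t' = amap G (fst q) \<odot> amap F (snd p)"
    using Beck_Chevalley[OF S(2) P] by simp
  also have "amap F (snd q) \<odot> (amap G (fst q) \<odot> amap F (snd p) \<odot> amap G (fst p)) = val q \<odot> val p"
    using a S by (simp add: val_def tgt.Comp_assoc_Arr)
  finally show ?thesis .
qed

text \<open>Beck-Chevalley expresses the value of a pullback span through its cospan, as
  \<open>G\<close> of the second leg after \<open>F\<close> of the first. There \<open>v\<close>
  enters as \<open>amap G v \<odot> amap F v\<close>, which the section identity removes.\<close>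

lemma val_cospan_le:
  assumes p: "p \<in> cospans C S" and q: "q \<in> cospans C S" and le: "cospan_le C S p q"
    and x: "x \<in> pbs C p" and y: "y \<in> pbs C q"
  shows "val x = val y"
proof -
  have S: "fst p \<in> Arr C" "snd p \<in> S" "fst q \<in> Arr C" "snd q \<in> S" "Cod C (fst p) = Cod C (snd p)"
    using p q by (auto simp: cospans_def)
  have X: "val x = amap G (snd p) \<odot> amap F (fst p)" and Y: "val y = amap G (snd q) \<odot> amap F (fst q)"
    using x y Beck_Chevalley S by (auto simp: pbs_def val_def)
  obtain v where v: "v \<in> S" "Dom C v = Cod C (fst p)"
      "v \<cdot> fst p = fst q" "v \<cdot> snd p = snd q"
    using le by (auto simp: cospan_le_def cospan_mor_def hom_def)
  have "val y = (amap G (snd p) \<odot> amap G v) \<odot> (amap F v \<odot> amap F (fst p))"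
    using Y F_Comp[of "fst p" v] G_Comp[of "snd p" v] S v by simp
  also have "\<dots> = amap G (snd p) \<odot> ((amap G v \<odot> amap F v) \<odot> amap F (fst p))"
    using S v(1,2) by (simp add: tgt.Comp_assoc_Arr)
  also have "\<dots> = val x"
    using G_F[OF v(1)] X S v(2) tgt.Comp_Ident(2)[of "amap F (fst p)"] by simp
  finally show ?thesis
    by simp
qed

lemma val_sim_a:
  assumes "(p, q) \<in> sim_a C S"
  shows "val p = val q"
proof -
  \<comment> \<open>Equality of values alone would not be compatible: spans with different endpoints
    may share a value, hence the restriction to \<open>parallel\<close>.\<close>
  define K where "K = {(p, q) \<in> parallel. val p = val q}"
  have "equiv (spans C S) K"
    by (auto simp: K_def parallel_def equiv_def refl_on_def sym_def trans_def)
  moreover have "compatible C S K"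
  proof -
    have "(x, y) \<in> K" if "(p, p') \<in> K" "(q, q') \<in> K" "x \<in> hcomps C q p" "y \<in> hcomps C q' p'"
      for p p' q q' x y
      using that hcomps_spans[of p q x] hcomps_spans[of p' q' y] val_hcomps[of p q x]
        val_hcomps[of p' q' y] by (simp add: K_def parallel_def)
    moreover have "(r, r) \<in> K" if "r \<in> spans C S" for r
      using that by (simp add: K_def parallel_def)
    moreover have "\<forall>p \<in> spans C S. \<forall>q \<in> spans C S. span_iso C p q \<longrightarrow> (p, q) \<in> K"
      using span_iso_parallel val_span_iso by (simp add: K_def)
    moreover have "\<forall>(p, q) \<in> K. p \<in> spans C S \<and> q \<in> spans C S \<and> sdom C p = sdom C q \<and>
        scod C p = scod C q"
      by (auto simp: K_def parallel_def)
    ultimately show ?thesis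
      unfolding compatible_def by blast
  qed
  then have "approx_a C S \<subseteq> K"
    using cospan_le_parallel val_cospan_le by (intro approx_a_least) (auto simp: K_def)
  ultimately have "sim_a C S \<subseteq> K"
    unfolding sim_a_def by (rule generated_equiv_least)
  then show ?thesis
    using assms by (auto simp: K_def)
qed

section \<open>The induced functor and its uniqueness\<close>

definition H :: "('o, ('a \<times> 'a) set, 'p, 'b) ftor" where
  "H = \<lparr>omap = omap F, amap = (\<lambda>P. the_elem (val ` P))\<rparr>"

text \<open>By \<open>val_sim_a\<close> the image of a class under \<open>val\<close> is a
  singleton, so \<open>the_elem\<close> returns the common value. Sets that are not classes get no
  meaningful value, and \<open>ftor_eq\<close> ignores them.\<close>

lemma H_cls: "p \<in> spans C S \<Longrightarrow> amap H (sect.cls p) = val p"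
  using sect.cls_self[of p] the_elem_image_unique[of "sect.cls p" val "val p"]
  by (fastforce simp: H_def dest: val_sim_a)

lemma H_omap: "omap H A = omap F A"
  by (simp add: H_def)

lemma val_Arr: "f \<in> Arr C \<Longrightarrow> val (Ident C (Dom C f), f) = amap F f"
  using tgt.Comp_Ident(1)[of "amap F f"] by (simp add: val_def G_Ident)

lemma val_S: "s \<in> S \<Longrightarrow> val (s, Ident C (Dom C s)) = amap G s"
  using tgt.Comp_Ident(2)[of "amap G s"] F.amap_Ident[of "Dom C s"] by (simp add: val_def)

lemma functor_H: "cat_functor (Sect C S) D H"
proof -
  \<comment> \<open>\<open>sect.Q\<close> is \<open>Sect C S\<close> by definition; in this form the
    facts on general quotients apply.\<close>
  have "cat_functor sect.Q D H"
  proof (intro cat_functor.intro cat_functor_axioms.intro)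
    show "category sect.Q"
      by (rule sect.category_Q)
    show "category D"
      by (rule tgt.category_axioms)
  next
    fix A assume "A \<in> Obj sect.Q"
    then have A: "A \<in> Obj C"
      by (simp add: sect.Obj_Q)
    then show "omap H A \<in> Obj D"
      by (simp add: H_omap F.omap_in_Obj)
    show "amap H (Ident sect.Q A) = Ident D (omap H A)"
      using A H_cls[OF sect.Ident_span[OF A]] val_Arr[of "Ident C A"] F.amap_Ident[OF A]
      by (simp add: sect.Ident_cls H_omap)
  next
    fix P A B assume "P \<in> hom sect.Q A B"
    then obtain p where "p \<in> spans C S" "P = sect.cls p" "sdom C p = A" "scod C p = B"
      by (rule sect.hom_clsE)
    then show "amap H P \<in> hom D (omap H A) (omap H B)"
      using H_cls[of p] val_in_hom[of p] by (simp add: H_omap)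
  next
    fix P P' X Y Z assume "P \<in> hom sect.Q X Y" "P' \<in> hom sect.Q Y Z"
    then obtain p q where p: "p \<in> spans C S" "P = sect.cls p" "scod C p = Y"
      and q: "q \<in> spans C S" "P' = sect.cls q" "sdom C q = Y"
      by (metis sect.hom_clsE)
    obtain x where x: "x \<in> hcomps C q p"
      using hcomps_nonempty[of p q] p q by auto
    show "amap H (Comp sect.Q P' P) = amap H P' \<odot> amap H P"
      using p q x sect.Comp_cls[of p q x] hcomps_spans(1)[of p q x] val_hcomps[of p q x]
      by (simp add: H_cls)
  qed
  then show ?thesis
    by (simp add: Sect_def)
qed

lemma H_Phi: "ftor_eq C F (ftor_comp H (Phi_a C S))"
  by (simp add: ftor_eq_def ftor_comp_def Phi_a_def H_omap H_cls val_Arr)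

lemma H_Psi: "ftor_eq (op_cat (wide_subcat C S)) G (ftor_comp H (Psi_a C S))"
  by (simp add: ftor_eq_def ftor_comp_def Psi_a_def H_omap H_cls val_S G_omap
      op_cat_def wide_subcat_def)

lemma H_unique:
  assumes H': "cat_functor (Sect C S) D H'"
    and Phi: "ftor_eq C F (ftor_comp H' (Phi_a C S))"
    and Psi: "ftor_eq (op_cat (wide_subcat C S)) G (ftor_comp H' (Psi_a C S))"
  shows "ftor_eq (Sect C S) H' H"
proof -
  interpret H': cat_functor sect.Q D H'
    using H' by (simp add: Sect_def)
  have "amap H' P = amap H P" if "P \<in> Arr sect.Q" for P
  proof -
    have "P \<in> hom sect.Q (Dom sect.Q P) (Cod sect.Q P)"
      using that by (simp add: hom_def)
    then obtain p where p: "p \<in> spans C S" "P = sect.cls p"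
      by (rule sect.hom_clsE)
    obtain s f where sf: "p = (s, f)" "s \<in> S" "f \<in> Arr C" "Dom C s = Dom C f"
      using p(1) by (auto simp: spans_def)
    let ?f = "(Ident C (Dom C f), f)" and ?s = "(s, Ident C (Dom C s))"
    have span: "?f \<in> spans C S" "?s \<in> spans C S"
      using Arr_spanI[OF sf(3)] S_spanI[OF sf(2)] .
    \<comment> \<open>The two factors of \<open>P\<close> are the images of \<open>f\<close> under
      \<open>Phi_a\<close> and of \<open>s\<close> under \<open>Psi_a\<close>, where the values of
      \<open>H'\<close> are prescribed.\<close>
    have "P = Comp sect.Q (sect.cls ?f) (sect.cls ?s)"
      using sect.Comp_cls[OF span(2,1)] hcomps_factor[of s f] p sf(1) by simp
    moreover have "sect.cls ?s \<in> hom sect.Q (Cod C s) (Dom C f)"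
      "sect.cls ?f \<in> hom sect.Q (Dom C f) (Cod C f)"
      using sect.cls_in_hom[OF span(1)] sect.cls_in_hom[OF span(2)] sf
      by (simp_all add: sdom_def scod_def)
    ultimately have "amap H' P = amap H' (sect.cls ?f) \<odot> amap H' (sect.cls ?s)"
      using H'.amap_Comp by simp
    also have "amap H' (sect.cls ?f) = amap F f"
      using Phi sf(3) by (simp add: ftor_eq_def ftor_comp_def Phi_a_def)
    also have "amap H' (sect.cls ?s) = amap G s"
      using Psi sf(2) by (simp add: ftor_eq_def ftor_comp_def Psi_a_def op_cat_def wide_subcat_def)
    finally show ?thesis
      using H_cls[OF p(1)] p(2) sf(1) by (simp add: val_def)
  qed
  \<comment> \<open>\<open>Phi_a\<close> is the identity on objects, so agreement with
    \<open>F\<close> already fixes the object part.\<close>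
  moreover have "omap H' A = omap H A" if "A \<in> Obj sect.Q" for A
    using Phi that by (simp add: ftor_eq_def ftor_comp_def Phi_a_def H_omap sect.Obj_Q)
  ultimately show ?thesis
    by (simp add: ftor_eq_def Sect_def)
qed

end

theorem theorem1:
  fixes C :: "('o, 'a) cat" and S :: "'a set" and D :: "('p, 'b) cat"
    and F G :: "('o, 'a, 'p, 'b) ftor"
  assumes "span_setting C S"
    and "cat_functor C D F"
    and "cat_functor (op_cat (wide_subcat C S)) D G"
    and "beck_chevalley C S D F G"
    and "\<forall>s \<in> S. Comp D (amap G s) (amap F s) = Ident D (omap F (Dom C s))"
  shows "\<exists>H.
    (cat_functor (Sect C S) D H \<and>
     ftor_eq C F (ftor_comp H (Phi_a C S)) \<and>
     ftor_eq (op_cat (wide_subcat C S)) G (ftor_comp H (Psi_a C S))) \<and>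
    (\<forall>H'.
      cat_functor (Sect C S) D H' \<and>
      ftor_eq C F (ftor_comp H' (Phi_a C S)) \<and>
      ftor_eq (op_cat (wide_subcat C S)) G (ftor_comp H' (Psi_a C S)) \<longrightarrow>
      ftor_eq (Sect C S) H' H)"
proof -
  interpret sect_pair C S D F G
    using assms cat_functor.axioms(2)[OF assms(2)]
    by (intro sect_pair.intro sect_pair_axioms.intro)
  show ?thesis
    using functor_H H_Phi H_Psi H_unique by blast
qed

end
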